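(* Let $k\ge 2$ and $n\ge k+2$ be integers. The group homomorphism $$\varphi:\mathfrak{S}_n\times\mathfrak{S}_{k-1}\to \mathrm{Aut}(S_{n,k}),\qquad \varphi(\mu,\nu):[a_1,\dots,a_k]\mapsto[\mu(a_{\nu^{-1}(1)}),\dots,\mu(a_{\nu^{-1}(k)})]$$ is an isomorphism. Moreover, let $v$ be a vertex of $S_{n,k}$ and let $u_1,\dots,u_{n-k}$ (resp. $w_1,\dots,w_{k-1}$) be the residual-adjacent (resp. star-adjacent) neighbors of $v$ arranged in any order; let $v'$ be a vertex of $S_{n,k}$ and let $u'_1,\dots,u'_{n-k}$ (resp. $w'_1,\dots,w'_{k-1}$) be the residual-adjacent (resp. star-adjacent) neighbors of $v'$ arranged in any order. Then there is a unique automorphism $f\in\mathrm{Aut}(S_{n,k})$ sending $v$ to $v'$, $u_i$ to $u'_i$ for $1\le i\le n-k$, and $w_i$ to $w'_i$ for $1\le i\le k-1$.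
   Context: A $k$-permutation on $\{1,\dots,n\}$ is an ordered $k$-tuple $[a_1,\dots,a_k]$ of distinct elements of $\{1,\dots,n\}$. The $(n,k)$-star graph $S_{n,k}$ is the simple undirected graph whose vertices are the $k$-permutations on $\{1,\dots,n\}$, with two types of edges: a star edge joins two vertices one of which is obtained from the other by exchanging the symbols in position $1$ and position $i$ for some $2\le i\le k$; a residual edge joins two vertices that differ only in their first position. A vertex $u$ is a residual-adjacent (resp. star-adjacent) neighbor of $v$ if $u$ and $v$ are joined by a residual (resp. star) edge; each vertex has $n-k$ residual-adjacent and $k-1$ star-adjacent neighbors. $\mathfrak{S}_n$ is the symmetric group on $\{1,\dots,n\}$, and $\mathfrak{S}_{k-1}\le\mathfrak{S}_n$ is the subgroup of permutations fixing each element of $\{1,k+1,\dots,n\}$ (i.e. permuting only $\{2,\dots,k\}$). $\mathrm{Aut}(S_{n,k})$ is the group of graph automorphisms of $S_{n,k}$. *)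

theory Defs
  imports "HOL-Algebra.Bij" "HOL-Algebra.Sym_Groups"
begin

text \<open>A tuple \<open>[a\<^sub>1, \<dots>, a\<^sub>k]\<close> is the function \<open>i \<mapsto> a\<^sub>i\<close> on \<open>{1..k}\<close>, extended by
  \<^const>\<open>undefined\<close> elsewhere so that equality of tuples is equality of functions.\<close>

definition k_perms :: "nat \<Rightarrow> nat \<Rightarrow> (nat \<Rightarrow> nat) set" where
  "k_perms n k = {a \<in> {1..k} \<rightarrow>\<^sub>E {1..n}. inj_on a {1..k}}"

text \<open>Edges are unordered pairs of vertices, represented as two-element sets.\<close>

definition star_edges :: "nat \<Rightarrow> nat \<Rightarrow> (nat \<Rightarrow> nat) set set" where
  "star_edges n k = {{a, a \<circ> transpose 1 i} | a i. a \<in> k_perms n k \<and> i \<in> {2..k}}"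

definition residual_edges :: "nat \<Rightarrow> nat \<Rightarrow> (nat \<Rightarrow> nat) set set" where
  "residual_edges n k =
     {{a, b} | a b. a \<in> k_perms n k \<and> b \<in> k_perms n k \<and>
                    a 1 \<noteq> b 1 \<and> (\<forall>i\<in>{2..k}. a i = b i)}"

definition nk_star_edges :: "nat \<Rightarrow> nat \<Rightarrow> (nat \<Rightarrow> nat) set set" where
  "nk_star_edges n k = star_edges n k \<union> residual_edges n k"

definition star_nbrs :: "nat \<Rightarrow> nat \<Rightarrow> (nat \<Rightarrow> nat) \<Rightarrow> (nat \<Rightarrow> nat) set" where
  "star_nbrs n k v = {u \<in> k_perms n k. {u, v} \<in> star_edges n k}"

definition residual_nbrs :: "nat \<Rightarrow> nat \<Rightarrow> (nat \<Rightarrow> nat) \<Rightarrow> (nat \<Rightarrow> nat) set" where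
  "residual_nbrs n k v = {u \<in> k_perms n k. {u, v} \<in> residual_edges n k}"

text \<open>As in \<^const>\<open>BijGroup\<close>, automorphisms are extensional: they are \<^const>\<open>undefined\<close>
  outside the vertex set, so that each one is a single element of the group.\<close>

definition graph_Aut :: "'v set \<Rightarrow> 'v set set \<Rightarrow> ('v \<Rightarrow> 'v) monoid" where
  "graph_Aut V E =
     (BijGroup V)\<lparr>carrier := {f \<in> Bij V. \<forall>x\<in>V. \<forall>y\<in>V. {f x, f y} \<in> E \<longleftrightarrow> {x, y} \<in> E}\<rparr>"

abbreviation nk_star_Aut :: "nat \<Rightarrow> nat \<Rightarrow> ((nat \<Rightarrow> nat) \<Rightarrow> (nat \<Rightarrow> nat)) monoid" where
  "nk_star_Aut n k \<equiv> graph_Aut (k_perms n k) (nk_star_edges n k)"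

definition sym_subgroup :: "nat \<Rightarrow> nat \<Rightarrow> (nat \<Rightarrow> nat) monoid" where
  "sym_subgroup n k =
     (sym_group n)\<lparr>carrier := {p \<in> carrier (sym_group n). \<forall>i\<in>insert 1 {k+1..n}. p i = i}\<rparr>"

definition phi ::
  "nat \<Rightarrow> nat \<Rightarrow> (nat \<Rightarrow> nat) \<times> (nat \<Rightarrow> nat) \<Rightarrow> (nat \<Rightarrow> nat) \<Rightarrow> (nat \<Rightarrow> nat)" where
  "phi n k = (\<lambda>(\<mu>, \<nu>). \<lambda>a\<in>k_perms n k. \<lambda>i\<in>{1..k}. \<mu> (a (inv_into UNIV \<nu> i)))"


lemma subgroup_graph_Aut: "subgroup (carrier (graph_Aut V E)) (BijGroup V)"
proof -
  interpret B: group "BijGroup V" by (rule group_BijGroup)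
  show ?thesis
  proof (rule B.subgroupI)
    show "carrier (graph_Aut V E) \<subseteq> carrier (BijGroup V)"
      by (auto simp: graph_Aut_def BijGroup_def)
    have "(\<lambda>x\<in>V. x) \<in> carrier (graph_Aut V E)"
      by (simp add: graph_Aut_def id_Bij)
    then show "carrier (graph_Aut V E) \<noteq> {}" by blast
  next
    fix f assume "f \<in> carrier (graph_Aut V E)"
    then have f: "f \<in> Bij V" and e: "\<And>x y. x \<in> V \<Longrightarrow> y \<in> V \<Longrightarrow> {f x, f y} \<in> E \<longleftrightarrow> {x, y} \<in> E"
      by (auto simp: graph_Aut_def)
    have "f (inv_into V f x) = x" "inv_into V f x \<in> V" if "x \<in> V" for x
      using f that by (auto simp: Bij_def bij_betw_def intro: f_inv_into_f inv_into_into)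
    then show "inv\<^bsub>BijGroup V\<^esub> f \<in> carrier (graph_Aut V E)"
      using f by (simp add: inv_BijGroup graph_Aut_def restrict_inv_into_Bij flip: e)
  next
    fix f g assume "f \<in> carrier (graph_Aut V E)" "g \<in> carrier (graph_Aut V E)"
    then have "f \<in> Bij V" "g \<in> Bij V" "\<And>x. x \<in> V \<Longrightarrow> g x \<in> V"
        "\<And>x y. x \<in> V \<Longrightarrow> y \<in> V \<Longrightarrow> {f x, f y} \<in> E \<longleftrightarrow> {x, y} \<in> E"
        "\<And>x y. x \<in> V \<Longrightarrow> y \<in> V \<Longrightarrow> {g x, g y} \<in> E \<longleftrightarrow> {x, y} \<in> E"
      by (auto simp: graph_Aut_def dest: Bij_imp_funcset[THEN funcset_mem])
    then show "f \<otimes>\<^bsub>BijGroup V\<^esub> g \<in> carrier (graph_Aut V E)"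
      by (simp add: graph_Aut_def BijGroup_def compose_Bij compose_eq)
  qed
qed

lemma group_graph_Aut: "group (graph_Aut V E)"
proof -
  have eq: "(BijGroup V)\<lparr>carrier := carrier (graph_Aut V E)\<rparr> = graph_Aut V E"
    by (simp add: graph_Aut_def)
  show ?thesis
    using subgroup.subgroup_is_group[OF subgroup_graph_Aut[of V E] group_BijGroup] unfolding eq .
qed

lemma carrier_sym_subgroup:
  assumes "k \<le> n"
  shows "carrier (sym_subgroup n k) = {p. p permutes {2..k}}"
proof -
  have "p permutes {2..k}" if "p permutes {1..n}" "\<forall>i\<in>insert 1 {k+1..n}. p i = i" for p
  proof (rule permutes_superset[OF that(1)])
    fix x assume "x \<in> {1..n} - {2..k}"
    then have "x \<in> insert 1 {k+1..n}" by auto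
    then show "p x = x" using that(2) by blast
  qed
  moreover have "p permutes {1..n}" if "p permutes {2..k}" for p
    by (rule permutes_subset[OF that]) (use assms in auto)
  moreover have "p i = i" if "p permutes {2..k}" "i \<notin> {2..k}" for p i
    using that by (auto simp: permutes_def)
  ultimately show ?thesis
    by (auto simp: sym_subgroup_def sym_group_carrier)
qed

lemma transpose_in_k_perms:
  assumes "a \<in> k_perms n k" "i \<in> {2..k}"
  shows "a \<circ> transpose 1 i \<in> k_perms n k"
proof -
  have p: "transpose 1 i permutes {1..k}"
    using assms(2) by (intro permutes_swap_id) auto
  have im: "transpose 1 i ` {1..k} = {1..k}"
    by (rule permutes_image[OF p])
  have "inj_on (a \<circ> transpose 1 i) {1..k}"
    by (rule comp_inj_on) (use assms(1) im in \<open>auto simp: k_perms_def\<close>)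
  moreover have "a \<circ> transpose 1 i \<in> {1..k} \<rightarrow>\<^sub>E {1..n}"
  proof (rule PiE_I)
    fix x assume "x \<in> {1..k}"
    then have "transpose 1 i x \<in> {1..k}" using im by blast
    moreover have "a \<in> {1..k} \<rightarrow>\<^sub>E {1..n}" using assms(1) by (simp add: k_perms_def)
    ultimately show "(a \<circ> transpose 1 i) x \<in> {1..n}" unfolding comp_apply by (rule PiE_mem[rotated])
  next
    fix x assume x: "x \<notin> {1..k}"
    have "a \<in> {1..k} \<rightarrow>\<^sub>E {1..n}" using assms(1) by (simp add: k_perms_def)
    then show "(a \<circ> transpose 1 i) x = undefined"
      using x unfolding comp_apply permutes_not_in[OF p x] by (rule PiE_arb)
  qed
  ultimately show ?thesis by (simp add: k_perms_def)
qed

lemma k_perms_inj: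
  assumes "a \<in> k_perms n k" "a i = a j" "i \<in> {1..k}" "j \<in> {1..k}"
  shows "i = j"
  using assms inj_onD unfolding k_perms_def by fastforce

lemma nk_star_simple:
  assumes "e \<in> nk_star_edges n k"
  shows "e \<subseteq> k_perms n k \<and> card e = 2"
proof -
  consider a i where "a \<in> k_perms n k" "i \<in> {2..k}" "e = {a, a \<circ> transpose 1 i}"
    | a b where "a \<in> k_perms n k" "b \<in> k_perms n k" "a 1 \<noteq> b 1" "e = {a, b}"
    using assms by (auto simp: nk_star_edges_def star_edges_def residual_edges_def)
  then show ?thesis
  proof cases
    case 1
    have "a i \<noteq> a 1" using k_perms_inj[OF 1(1), of i 1] 1(2) by auto
    then have "a \<noteq> a \<circ> transpose 1 i" by (metis comp_apply transpose_apply_first)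
    then show ?thesis using 1 transpose_in_k_perms by auto
  next
    case 2
    then have "a \<noteq> b" by blast
    then show ?thesis using 2 by simp
  qed
qed

lemma card_star_nbrs:
  assumes v: "v \<in> k_perms n k"
  shows "card (star_nbrs n k v) = k - 1"
proof -
  have "star_nbrs n k v = (\<lambda>i. v \<circ> transpose 1 i) ` {2..k}"
  proof (intro Set.set_eqI iffI)
    fix u assume "u \<in> star_nbrs n k v"
    then obtain a i where i: "i \<in> {2..k}" and uv: "{u, v} = {a, a \<circ> transpose 1 i}"
      by (auto simp: star_nbrs_def star_edges_def)
    have "a \<circ> transpose 1 i \<circ> transpose 1 i = a" by (simp add: comp_assoc)
    then have "u = v \<circ> transpose 1 i" using uv by (auto simp: doubleton_eq_iff)
    then show "u \<in> (\<lambda>i. v \<circ> transpose 1 i) ` {2..k}" using i by blast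
  next
    fix u assume "u \<in> (\<lambda>i. v \<circ> transpose 1 i) ` {2..k}"
    then obtain i where i: "i \<in> {2..k}" "u = v \<circ> transpose 1 i" by blast
    then have "{u, v} = {v, v \<circ> transpose 1 i}" by blast
    then have "{u, v} \<in> star_edges n k" unfolding star_edges_def using v i(1) by blast
    then show "u \<in> star_nbrs n k v"
      using i transpose_in_k_perms[OF v i(1)] by (simp add: star_nbrs_def)
  qed
  moreover have "inj_on (\<lambda>i. v \<circ> transpose 1 i) {2..k}"
  proof (rule inj_onI)
    fix i j assume ij: "i \<in> {2..k}" "j \<in> {2..k}" "v \<circ> transpose 1 i = v \<circ> transpose 1 j"
    have "v i = v j" using fun_cong[OF ij(3), of 1] by simp
    then show "i = j" using k_perms_inj[OF v, of i j] ij(1,2) by auto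
  qed
  ultimately show ?thesis by (simp add: card_image)
qed

lemma card_residual_nbrs:
  assumes v: "v \<in> k_perms n k" and k: "k \<ge> 1"
  shows "card (residual_nbrs n k v) = n - k"
proof -
  have V: "v ` {1..k} \<subseteq> {1..n}" "inj_on v {1..k}" using v by (auto simp: k_perms_def)
  have "residual_nbrs n k v = (\<lambda>x. v(1 := x)) ` ({1..n} - v ` {1..k})"
  proof (intro Set.set_eqI iffI)
    fix u assume "u \<in> residual_nbrs n k v"
    then have u: "u \<in> k_perms n k" "u 1 \<noteq> v 1" "\<And>i. i \<in> {2..k} \<Longrightarrow> u i = v i"
      by (auto simp: residual_nbrs_def residual_edges_def doubleton_eq_iff)
    have "u i = (v(1 := u 1)) i" for i
      using u v by (cases "i \<in> {2..k}"; cases "i = 1") (auto simp: k_perms_def PiE_def extensional_def)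
    then have "u = v(1 := u 1)" by (rule ext)
    moreover have "u 1 \<in> {1..n}" using u(1) k by (auto simp: k_perms_def)
    moreover have "u 1 \<noteq> v i" if "i \<in> {1..k}" for i
    proof (cases "i = 1")
      case False
      then have i: "i \<in> {2..k}" using that by auto
      have "u i \<noteq> u 1" using k_perms_inj[OF u(1), of i 1] i by auto
      then show ?thesis using u(3)[OF i] by simp
    qed (use u(2) in simp)
    ultimately show "u \<in> (\<lambda>x. v(1 := x)) ` ({1..n} - v ` {1..k})" by blast
  next
    fix u assume "u \<in> (\<lambda>x. v(1 := x)) ` ({1..n} - v ` {1..k})"
    then obtain x where x: "x \<in> {1..n}" "x \<notin> v ` {1..k}" and u: "u = v(1 := x)" by blast
    have "u \<in> {1..k} \<rightarrow>\<^sub>E {1..n}"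
      using v x(1) k u by (auto simp: k_perms_def PiE_def extensional_def)
    moreover have "inj_on u {1..k}"
      unfolding u by (rule inj_on_fun_updI[OF V(2) x(2)])
    ultimately have uV: "u \<in> k_perms n k" by (simp add: k_perms_def)
    have "u 1 \<noteq> v 1" using x(2) k u by (metis atLeastAtMost_iff fun_upd_same imageI order_refl)
    moreover have "\<forall>i\<in>{2..k}. u i = v i" using u by auto
    ultimately show "u \<in> residual_nbrs n k v"
      unfolding residual_nbrs_def residual_edges_def using uV v by blast
  qed
  moreover have "inj_on (\<lambda>x. v(1 := x)) A" for A
    by (rule inj_onI) (metis fun_upd_same)
  moreover have "card ({1..n} - v ` {1..k}) = n - k"
    using V by (simp add: card_Diff_subset card_image)
  ultimately show ?thesis by (simp add: card_image)
qed

end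

(* Every residual edge lies in a triangle because there are at least two unused symbols, and no
   star edge does, so automorphisms preserve the two types of edges. Automorphisms f and g that
   agree on a vertex v and its neighbours then agree on the neighbours of each neighbour u of v: a
   neighbour of u outside the residual clique of v is the only one that closes a 6-cycle of a fixed
   pattern of edge types through u, v and a suitable further neighbour of v. Since the graph is
   connected, f = g. Conversely, every assignment of v and its neighbours to v' and its neighbours
   is realised by some phi(mu, nu): nu is read off the star neighbours, mu off v, nu and the
   residual neighbours. Surjectivity of phi and the second claim both follow. *)

theory Submission
  imports Defs
begin

section \<open>Enumerations, permutations and transpositions\<close>

lemma permutation_between_enumerations:
  assumes f: "bij_betw f I A" and g: "bij_betw g I A"
  obtains \<pi> where "\<pi> permutes A" "\<And>i. i \<in> I \<Longrightarrow> \<pi> (f i) = g i"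
proof
  define \<pi> where "\<pi> x = (if x \<in> A then g (inv_into I f x) else x)" for x
  have "bij_betw (g \<circ> inv_into I f) A A"
    using bij_betw_trans[OF bij_betw_inv_into[OF f] g] .
  then have "bij_betw \<pi> A A" by (rule bij_betw_cong[THEN iffD1, rotated]) (simp add: \<pi>_def)
  then show "\<pi> permutes A" by (rule bij_imp_permutes) (simp add: \<pi>_def)
  show "\<pi> (f i) = g i" if "i \<in> I" for i
    using that f bij_betw_inv_into_left[OF f that] bij_betwE[OF f] by (simp add: \<pi>_def)
qed

lemma bij_betw_case_sum:
  assumes "bij_betw f I A" "bij_betw g J B" "A \<inter> B = {}"
  shows "bij_betw (case_sum f g) (I <+> J) (A \<union> B)"
  using assms unfolding bij_betw_def inj_on_def
  by (auto simp: image_iff Plus_def ball_Un bex_Un)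

lemma enumeration_through_bijection:
  assumes h: "bij_betw h F N" and u: "bij_betw u I N"
  obtains p where "bij_betw p I F" "\<And>i. i \<in> I \<Longrightarrow> u i = h (p i)"
proof
  show "bij_betw (inv_into F h \<circ> u) I F"
    using bij_betw_trans[OF u bij_betw_inv_into[OF h]] .
  show "u i = h ((inv_into F h \<circ> u) i)" if "i \<in> I" for i
    using that bij_betwE[OF u] h by (simp add: bij_betw_inv_into_right)
qed

lemma transpose_in_positions_iff:
  "(i::nat) \<in> {2..k} \<Longrightarrow> transpose 1 i x \<in> {1..k} \<longleftrightarrow> x \<in> {1..k}"
  by (auto simp: transpose_def)

text \<open>If \<open>j'\<close> differs from \<open>j\<close>, the left side fixes
  \<open>j'\<close>. Following \<open>j'\<close> through the right side then forces
  \<open>r = j'\<close> and \<open>q = p\<close>, so the right side collapses to the identity,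
  whereas the left side sends 1 to \<open>j\<close>.\<close>

lemma star_transposition_relation:
  assumes ne: "j' \<noteq> i" "j \<noteq> i" "p \<noteq> j'" and ge: "1 < i" "1 < j" "1 < j'" "1 < p" "1 < q" "(1::nat) < r"
    and eq: "transpose 1 i \<circ> transpose 1 j =
      transpose 1 j' \<circ> transpose 1 p \<circ> transpose 1 q \<circ> transpose 1 r"
  shows "j' = j"
proof (rule ccontr)
  assume "j' \<noteq> j"
  then have "transpose 1 j' (transpose 1 p (transpose 1 q (transpose 1 r j'))) = j'"
    using fun_cong[OF eq, of j'] ne ge by simp
  then have "r = j'" "q = p"
    using ne ge by (auto simp: transpose_def split: if_splits)
  then have "transpose 1 i (transpose 1 j 1) = 1" using fun_cong[OF eq, of 1] by simp
  then show False using ne ge by (auto simp: transpose_def split: if_splits)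
qed

section \<open>Edges in coordinates\<close>

lemma star_edge_iff:
  "{a, b} \<in> star_edges n k \<longleftrightarrow> a \<in> k_perms n k \<and> (\<exists>i\<in>{2..k}. b = a \<circ> transpose 1 i)"
proof
  assume "{a, b} \<in> star_edges n k"
  then obtain c i where c: "c \<in> k_perms n k" "i \<in> {2..k}" "{a, b} = {c, c \<circ> transpose 1 i}"
    by (auto simp: star_edges_def)
  \<comment> \<open>The exchange is an involution, so the edge has the same form when read from its
    other end.\<close>
  have "c = (c \<circ> transpose 1 i) \<circ> transpose 1 i" by (simp add: comp_assoc)
  then show "a \<in> k_perms n k \<and> (\<exists>i\<in>{2..k}. b = a \<circ> transpose 1 i)"
    using c transpose_in_k_perms[OF c(1,2)] by (auto simp: doubleton_eq_iff)
qed (unfold star_edges_def, blast)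

lemma residual_edge_iff:
  "{a, b} \<in> residual_edges n k \<longleftrightarrow>
     a \<in> k_perms n k \<and> b \<in> k_perms n k \<and> a 1 \<noteq> b 1 \<and> (\<forall>i\<in>{2..k}. a i = b i)"
proof
  assume "{a, b} \<in> residual_edges n k"
  then obtain c d where "{a, b} = {c, d}" "c \<in> k_perms n k" "d \<in> k_perms n k" "c 1 \<noteq> d 1"
      "\<forall>i\<in>{2..k}. c i = d i"
    unfolding residual_edges_def by blast
  then show "a \<in> k_perms n k \<and> b \<in> k_perms n k \<and> a 1 \<noteq> b 1 \<and> (\<forall>i\<in>{2..k}. a i = b i)"
    by (auto simp: doubleton_eq_iff)
qed (unfold residual_edges_def, blast)

lemma k_perms_eqI:
  assumes "a \<in> k_perms n k" "b \<in> k_perms n k" "\<And>i. i \<in> {1..k} \<Longrightarrow> a i = b i"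
  shows "a = b"
  by (rule PiE_ext[of a "{1..k}" "\<lambda>_. {1..n}" b])
    (use assms in \<open>auto simp only: k_perms_def mem_Collect_eq\<close>)

lemma k_perms_fun_upd:
  assumes "a \<in> k_perms n k" "i \<in> {1..k}" "y \<in> {1..n} - a ` {1..k}"
  shows "a(i := y) \<in> k_perms n k"
proof -
  have "a(i := y) \<in> {1..k} \<rightarrow>\<^sub>E {1..n}"
    using assms by (auto simp: k_perms_def PiE_def extensional_def)
  then show ?thesis
    using assms by (auto simp: k_perms_def intro: inj_on_fun_updI)
qed

lemma k_perms_range: "a \<in> k_perms n k \<Longrightarrow> i \<in> {1..k} \<Longrightarrow> a i \<in> {1..n}"
  by (auto simp: k_perms_def)

lemma k_perms_eq_iff:
  "a \<in> k_perms n k \<Longrightarrow> i \<in> {1..k} \<Longrightarrow> j \<in> {1..k} \<Longrightarrow> a i = a j \<longleftrightarrow> i = j"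
  using k_perms_inj by blast

lemma residual_edge_iff_upd:
  assumes "k \<ge> 1"
  shows "{a, b} \<in> residual_edges n k \<longleftrightarrow>
     a \<in> k_perms n k \<and> (\<exists>x\<in>{1..n} - a ` {1..k}. b = a(1 := x))" (is "_ \<longleftrightarrow> ?R")
proof
  assume "{a, b} \<in> residual_edges n k"
  then have ab: "a \<in> k_perms n k" "b \<in> k_perms n k" "a 1 \<noteq> b 1" "\<And>i. i \<in> {2..k} \<Longrightarrow> a i = b i"
    by (auto simp: residual_edge_iff)
  have "b 1 \<noteq> a i" if "i \<in> {1..k}" for i
  proof (cases "i = 1")
    case False
    then have i: "i \<in> {2..k}" using that by auto
    then show ?thesis using ab(4)[OF i] k_perms_eq_iff[OF ab(2), of 1 i] by auto
  qed (use ab in simp)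
  then have x: "b 1 \<in> {1..n} - a ` {1..k}"
    using k_perms_range[OF ab(2), of 1] assms by (metis DiffI atLeastAtMost_iff imageE order_refl)
  have "b = a(1 := b 1)"
  proof (rule k_perms_eqI[OF ab(2) k_perms_fun_upd[OF ab(1) _ x]])
    show "b i = (a(1 := b 1)) i" if "i \<in> {1..k}" for i
      using ab(4)[of i] that by (cases "i = 1") auto
  qed (use assms in auto)
  then show ?R using ab(1) x by blast
next
  assume ?R
  then obtain x where x: "a \<in> k_perms n k" "x \<in> {1..n} - a ` {1..k}" "b = a(1 := x)" by blast
  moreover have "a 1 \<noteq> x" using x(2) assms by force
  ultimately show "{a, b} \<in> residual_edges n k"
    using k_perms_fun_upd[OF x(1) _ x(2), of 1] assms by (auto simp: residual_edge_iff)
qed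

section \<open>The two kinds of edges, told apart by triangles\<close>

locale star_graph =
  fixes n k :: nat
  assumes k: "k \<ge> 2" and n: "n \<ge> k + 2"
begin

abbreviation "V \<equiv> k_perms n k"
abbreviation "S \<equiv> star_edges n k"
abbreviation "R \<equiv> residual_edges n k"
abbreviation "E \<equiv> nk_star_edges n k"

lemma residual_edge_upd: "{a, b} \<in> R \<longleftrightarrow> a \<in> V \<and> (\<exists>x\<in>{1..n} - a ` {1..k}. b = a(1 := x))"
  using residual_edge_iff_upd k by simp

lemma E_iff: "e \<in> E \<longleftrightarrow> e \<in> S \<or> e \<in> R"
  by (simp add: nk_star_edges_def)

lemma edge_in_V: "{a, b} \<in> E \<Longrightarrow> a \<in> V \<and> b \<in> V"
  using nk_star_simple by blast

lemma card_fresh: "a \<in> V \<Longrightarrow> card ({1..n} - a ` {1..k}) = n - k"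
  by (subst card_Diff_subset) (auto simp: k_perms_def card_image)

lemma fresh_symbol:
  assumes "a \<in> V"
  obtains y where "y \<in> {1..n} - a ` {1..k}" "y \<noteq> x"
proof -
  have "card ({1..n} - a ` {1..k}) \<ge> 2" using card_fresh[OF assms] n by simp
  then have "\<not> {1..n} - a ` {1..k} \<subseteq> {x}"
    using card_mono[of "{x}" "{1..n} - a ` {1..k}"] by auto
  then show thesis using that by blast
qed

lemma star_edge_not_residual: "{a, b} \<in> S \<Longrightarrow> {a, b} \<notin> R"
proof
  assume "{a, b} \<in> S" "{a, b} \<in> R"
  then obtain i where i: "a \<in> V" "i \<in> {2..k}" "b = a \<circ> transpose 1 i" and "a i = b i"
    unfolding star_edge_iff residual_edge_iff by blast
  then have "a i = a 1" by simp
  then show False using k_perms_eq_iff[OF i(1), of i 1] i(2) by auto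
qed

lemma residual_edge_in_triangle:
  assumes "{a, b} \<in> R"
  shows "\<exists>c. {a, c} \<in> E \<and> {b, c} \<in> E"
proof -
  obtain x where x: "a \<in> V" "x \<in> {1..n} - a ` {1..k}" "b = a(1 := x)"
    using assms residual_edge_upd by blast
  obtain y where y: "y \<in> {1..n} - a ` {1..k}" "y \<noteq> x" using fresh_symbol[OF x(1)] by blast
  have "{a, a(1 := y)} \<in> R" using x y residual_edge_upd by blast
  moreover from this assms have "{b, a(1 := y)} \<in> R" using x y by (auto simp: residual_edge_iff)
  ultimately show ?thesis unfolding E_iff by blast
qed

lemma star_edge_not_in_triangle:
  assumes "{a, b} \<in> S"
  shows "\<not> ({a, c} \<in> E \<and> {b, c} \<in> E)"
proof
  assume c: "{a, c} \<in> E \<and> {b, c} \<in> E"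
  obtain i where i: "a \<in> V" "i \<in> {2..k}" "b = a \<circ> transpose 1 i"
    using assms star_edge_iff by blast
  have inj: "a p = a q \<longleftrightarrow> p = q" if "p \<in> {1..k}" "q \<in> {1..k}" for p q
    using k_perms_eq_iff[OF i(1)] that by blast
  have a1i: "a 1 \<noteq> a i" using inj[of 1 i] i(2) by auto
  consider "{a, c} \<in> R" "{b, c} \<in> R" | "{a, c} \<in> R" "{b, c} \<in> S"
    | "{a, c} \<in> S" "{b, c} \<in> R" | "{a, c} \<in> S" "{b, c} \<in> S"
    using c E_iff by blast
  then show False
  proof cases
    case 1
    then have "a i = c i" "b i = c i" using i(2) by (auto simp: residual_edge_iff)
    then show False using i(3) a1i by simp
  next
    case 2
    then obtain x l where "x \<notin> a ` {1..k}" "l \<in> {2..k}" "a(1 := x) = b \<circ> transpose 1 l"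
      unfolding star_edge_iff residual_edge_upd by blast
    moreover from fun_cong[OF this(3), of 1] have "x = a (transpose 1 i l)" using i by simp
    ultimately show False using i(2) by (auto simp: transpose_def split: if_splits)
  next
    case 3
    then obtain j where j: "j \<in> {2..k}" "c = a \<circ> transpose 1 j" using star_edge_iff by blast
    \<comment> \<open>Agreement at position \<open>i\<close> forces \<open>j = i\<close>, hence
      \<open>c = b\<close>, against the difference at position 1.\<close>
    have "b i = c i" "b 1 \<noteq> c 1" using 3(2) i(2) unfolding residual_edge_iff by blast+
    then show False using i j a1i by (auto simp: transpose_def split: if_splits)
  next
    case 4
    then obtain j l where j: "j \<in> {2..k}" "l \<in> {2..k}" "a \<circ> transpose 1 j = b \<circ> transpose 1 l"
      unfolding star_edge_iff by blast
    \<comment> \<open>Position 1 forces \<open>l\<close> to differ from \<open>i\<close> and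
      \<open>j = l\<close>; position \<open>i\<close> then yields \<open>a i = a 1\<close>.\<close>
    have "a j = a (transpose 1 i l)" using fun_cong[OF j(3), of 1] i by simp
    then have jl: "j = transpose 1 i l"
      using inj[of j "transpose 1 i l"] i j by (auto simp: transpose_def split: if_splits)
    have "a (transpose 1 j i) = a (transpose 1 i (transpose 1 l i))"
      using fun_cong[OF j(3), of i] i by simp
    then show False using jl i j a1i by (auto simp: transpose_def split: if_splits)
  qed
qed

text \<open>The right side speaks of edges without their types, so it is invariant under
  automorphisms; this recovers the types from the graph alone.\<close>

lemma residual_edge_iff_triangle:
  "{a, b} \<in> R \<longleftrightarrow> {a, b} \<in> E \<and> (\<exists>c. {a, c} \<in> E \<and> {b, c} \<in> E)"
  using residual_edge_in_triangle star_edge_not_in_triangle E_iff by blast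

lemma star_edge_iff_not_residual: "{a, b} \<in> S \<longleftrightarrow> {a, b} \<in> E \<and> {a, b} \<notin> R"
  using star_edge_not_residual E_iff by blast

section \<open>Six-cycles that determine second neighbours\<close>

lemma res_star_res:
  assumes "{v, u} \<in> R" "{u, b} \<in> S"
  shows "\<exists>w. {v, w} \<in> S \<and> (\<exists>c d. {w, c} \<in> R \<and> {c, d} \<in> S \<and> {d, b} \<in> R)"
proof -
  obtain x where v: "v \<in> V" "x \<in> {1..n} - v ` {1..k}" "u = v(1 := x)"
    using assms residual_edge_upd by blast
  obtain i where u: "u \<in> V" "i \<in> {2..k}" "b = u \<circ> transpose 1 i"
    using assms star_edge_iff by blast
  \<comment> \<open>With the rest of \<open>v\<close> kept, the six vertices are the ways to place
    two of the three symbols \<open>v 1\<close>, \<open>v i\<close>, \<open>x\<close> at positions 1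
    and \<open>i\<close>; residual and star edges alternate around the cycle.\<close>
  define w where "w = v \<circ> transpose 1 i"
  have w: "w \<in> V" "{v, w} \<in> S" using v u transpose_in_k_perms star_edge_iff by (auto simp: w_def)
  have im: "w ` {1..k} \<subseteq> v ` {1..k}" using u(2) by (auto simp: w_def transpose_def)
  define c where "c = w(1 := x)"
  have c: "{w, c} \<in> R" using w im v(2) residual_edge_upd unfolding c_def by blast
  then have cV: "c \<in> V" using E_iff edge_in_V by blast
  define d where "d = c \<circ> transpose 1 i"
  have d: "{c, d} \<in> S" "d \<in> V" using u(2) cV transpose_in_k_perms star_edge_iff by (auto simp: d_def)
  have "b \<in> V" using u transpose_in_k_perms by simp
  moreover have "v 1 \<noteq> v i" using k_perms_eq_iff[OF v(1), of 1 i] u(2) by auto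
  ultimately have "{d, b} \<in> R"
    using d(2) u(2) by (auto simp: residual_edge_iff d_def c_def w_def u(3) v(3) transpose_def)
  then show ?thesis using w c d by blast
qed

lemma res_star_res_unique:
  assumes "{v, u} \<in> R" "{v, w} \<in> S"
    and b: "{u, b} \<in> S" "{w, c} \<in> R \<and> {c, d} \<in> S \<and> {d, b} \<in> R"
    and b': "{u, b'} \<in> S" "{w, c'} \<in> R \<and> {c', d'} \<in> S \<and> {d', b'} \<in> R"
  shows "b = b'"
proof -
  obtain x where v: "v \<in> V" "x \<in> {1..n} - v ` {1..k}" "u = v(1 := x)"
    using assms residual_edge_upd by blast
  obtain i where i: "i \<in> {2..k}" "w = v \<circ> transpose 1 i"
    using assms star_edge_iff by blast
  have "b = u \<circ> transpose 1 i" if b: "{u, b} \<in> S" "{w, c} \<in> R" "{c, d} \<in> S" "{d, b} \<in> R" for b c d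
  proof -
    obtain j where j: "j \<in> {2..k}" "b = u \<circ> transpose 1 j" using b star_edge_iff by blast
    obtain p where p: "p \<in> {2..k}" "d = c \<circ> transpose 1 p" using b star_edge_iff by blast
    \<comment> \<open>On the path from \<open>w\<close> through \<open>c\<close> and
      \<open>d\<close> to \<open>b\<close>, the only position besides 1 that can change is
      \<open>p\<close>.\<close>
    have eq: "w q = b q" if "q \<in> {2..k}" "q \<noteq> p" for q
    proof -
      have "w q = c q" "d q = b q" using b(2,4) that(1) by (auto simp: residual_edge_iff)
      then show ?thesis using p(2) that by simp
    qed
    \<comment> \<open>If \<open>j\<close> differed from \<open>i\<close>, then \<open>w\<close> and
      \<open>b\<close> would differ at both of these positions, while \<open>p\<close> can equal
      only one of them.\<close>
    have "v 1 \<noteq> v i" using k_perms_eq_iff[OF v(1), of 1 i] i(1) by auto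
    moreover have "v j \<noteq> x" using v(2) j(1) by force
    ultimately show ?thesis
      using eq[of i] eq[of j] i j v(3) by (cases "i = j") (auto simp: transpose_def split: if_splits)
  qed
  then show ?thesis using b b' by metis
qed

lemma star_edge_image:
  assumes "{a, b} \<in> S"
  shows "b ` {1..k} = a ` {1..k}"
proof -
  obtain i where i: "i \<in> {2..k}" "b = a \<circ> transpose 1 i" using assms star_edge_iff by blast
  have "transpose 1 i ` {1..k} = {1..k}"
    using i(1) by (intro permutes_image permutes_swap_id) auto
  then show ?thesis using i(2) by (metis image_comp)
qed

lemma star_res_star:
  assumes "{v, u} \<in> S" "{u, b} \<in> R"
  shows "\<exists>w. {v, w} \<in> R \<and> (\<exists>c d. {w, c} \<in> S \<and> {c, d} \<in> R \<and> {d, b} \<in> S)"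
proof -
  obtain i where v: "v \<in> V" "i \<in> {2..k}" "u = v \<circ> transpose 1 i"
    using assms star_edge_iff by blast
  obtain x where u: "u \<in> V" "x \<in> {1..n} - u ` {1..k}" "b = u(1 := x)"
    using assms residual_edge_upd by blast
  have x: "x \<in> {1..n} - v ` {1..k}" using u(2) star_edge_image[OF assms(1)] by simp
  \<comment> \<open>The same alternating six-cycle as in \<open>res_star_res\<close>, now with
    \<open>u\<close> reached from \<open>v\<close> along its star edge.\<close>
  define w where "w = v(1 := x)"
  have w: "{v, w} \<in> R" using v(1) x residual_edge_upd by (auto simp: w_def)
  then have wV: "w \<in> V" using E_iff edge_in_V by blast
  define c where "c = w \<circ> transpose 1 i"
  have c: "{w, c} \<in> S" "c \<in> V" using wV v transpose_in_k_perms star_edge_iff by (auto simp: c_def)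
  define d where "d = b \<circ> transpose 1 i"
  have bV: "b \<in> V" using assms(2) E_iff edge_in_V by blast
  then have d: "{b, d} \<in> S" "d \<in> V" using v transpose_in_k_perms star_edge_iff by (auto simp: d_def)
  have "v 1 \<noteq> v i" using k_perms_eq_iff[OF v(1), of 1 i] v(2) by auto
  then have "{c, d} \<in> R"
    using c d v(2) by (auto simp: residual_edge_iff d_def c_def w_def u(3) v(3) transpose_def)
  moreover have "{d, b} \<in> S" using d(1) by (simp add: insert_commute)
  ultimately show ?thesis using w c(1) by blast
qed

lemma star_res_star_unique:
  assumes "{v, u} \<in> S" "{v, w} \<in> R"
    and b: "{u, b} \<in> R" "{w, c} \<in> S \<and> {c, d} \<in> R \<and> {d, b} \<in> S"
    and b': "{u, b'} \<in> R" "{w, c'} \<in> S \<and> {c', d'} \<in> R \<and> {d', b'} \<in> S"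
  shows "b = b'"
proof -
  obtain i where v: "v \<in> V" "i \<in> {2..k}" "u = v \<circ> transpose 1 i"
    using assms star_edge_iff by blast
  obtain x where x: "x \<in> {1..n} - v ` {1..k}" "w = v(1 := x)"
    using assms residual_edge_upd by blast
  have "b = u(1 := x)" if b: "{u, b} \<in> R" "{w, c} \<in> S" "{c, d} \<in> R" "{d, b} \<in> S" for b c d
  proof -
    obtain y where y: "y \<in> {1..n} - u ` {1..k}" "b = u(1 := y)" using b residual_edge_upd by blast
    obtain p where p: "p \<in> {2..k}" "c = w \<circ> transpose 1 p" using b star_edge_iff by blast
    obtain z where z: "d = c(1 := z)" using b residual_edge_upd by blast
    obtain q where q: "q \<in> {2..k}" "b = d \<circ> transpose 1 q" using b star_edge_iff by blast
    have sub: "b j \<in> insert z (w ` {1..k})" if "j \<in> {1..k}" for j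
      using p q z that by (auto simp: transpose_def)
    have "v 1 \<noteq> v j" if "j \<in> {2..k}" for j using k_perms_eq_iff[OF v(1), of 1 j] that by auto
    moreover have "v 1 \<noteq> x" using x(1) k by force
    ultimately have "v 1 \<noteq> w j" if "j \<in> {1..k}" for j
      using x(2) that by (cases "j = 1") auto
    then have "v 1 \<notin> w ` {1..k}" by blast
    moreover have "b i = v 1" using y v by auto
    ultimately have z: "z = v 1" using sub[of i] v(2) by auto
    have y': "y \<notin> v ` {1..k}" using y(1) star_edge_image[OF assms(1)] by blast
    moreover have "1 \<in> {1..k}" using k by simp
    ultimately have "y \<noteq> z" using z by blast
    then have "y \<in> w ` {1..k}" using sub[OF \<open>1 \<in> {1..k}\<close>] y(2) by simp
    then have "y = x" using x(2) y' by (auto split: if_splits)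
    then show ?thesis using y by simp
  qed
  then show ?thesis using b b' by metis
qed

lemma star_star_star:
  assumes "{v, u} \<in> S" "{u, b} \<in> S" "b \<noteq> v"
  shows "\<exists>w. {v, w} \<in> S \<and> w \<noteq> u \<and>
           (\<exists>c d. c \<noteq> v \<and> {w, c} \<in> S \<and> {c, d} \<in> S \<and> {d, b} \<in> S)"
proof -
  obtain i where v: "v \<in> V" "i \<in> {2..k}" "u = v \<circ> transpose 1 i"
    using assms star_edge_iff by blast
  obtain j where u: "u \<in> V" "j \<in> {2..k}" "b = u \<circ> transpose 1 j"
    using assms star_edge_iff by blast
  have ij: "i \<noteq> j" using assms(3) v u by (auto simp: comp_assoc)
  define w c d where "w = v \<circ> transpose 1 j" and "c = w \<circ> transpose 1 i" and "d = c \<circ> transpose 1 j"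
  have V: "w \<in> V" "c \<in> V" "d \<in> V"
    using v u transpose_in_k_perms by (simp_all add: w_def c_def d_def)
  \<comment> \<open>The transpositions of 1 with \<open>i\<close> and of 1 with \<open>j\<close>
    have a product of order three, so alternating them six times closes up.\<close>
  have b: "b = d \<circ> transpose 1 i"
    unfolding d_def c_def w_def u(3) v(3) using ij v(2) u(2) by (auto simp: fun_eq_iff transpose_def)
  have "v i \<noteq> v j" "v i \<noteq> v 1" using k_perms_eq_iff[OF v(1)] ij v(2) u(2) by auto
  then have "w 1 \<noteq> u 1" "c 1 \<noteq> v 1" using ij v(2,3) u(2)
    by (auto simp: w_def c_def transpose_def)
  then have "w \<noteq> u" "c \<noteq> v" by auto
  moreover have "{v, w} \<in> S" "{w, c} \<in> S" "{c, d} \<in> S" "{d, b} \<in> S"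
    unfolding star_edge_iff using V v(1,2) u(2) b w_def c_def d_def by blast+
  ultimately show ?thesis by blast
qed

lemma star_star_star_unique:
  assumes "{v, u} \<in> S" "{v, w} \<in> S" "w \<noteq> u"
    and b: "{u, b} \<in> S" "b \<noteq> v" "c \<noteq> v \<and> {w, c} \<in> S \<and> {c, d} \<in> S \<and> {d, b} \<in> S"
    and b': "{u, b'} \<in> S" "b' \<noteq> v" "c' \<noteq> v \<and> {w, c'} \<in> S \<and> {c', d'} \<in> S \<and> {d', b'} \<in> S"
  shows "b = b'"
proof -
  obtain i where v: "v \<in> V" "i \<in> {2..k}" "u = v \<circ> transpose 1 i"
    using assms star_edge_iff by blast
  obtain l where l: "l \<in> {2..k}" "w = v \<circ> transpose 1 l"
    using assms star_edge_iff by blast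
  have "b = u \<circ> transpose 1 l"
    if b: "{u, b} \<in> S" "b \<noteq> v" "c \<noteq> v" "{w, c} \<in> S" "{c, d} \<in> S" "{d, b} \<in> S" for b c d
  proof -
    obtain j where j: "j \<in> {2..k}" "b = u \<circ> transpose 1 j" using b star_edge_iff by blast
    obtain p q r where p: "p \<in> {2..k}" "c = w \<circ> transpose 1 p" and q: "q \<in> {2..k}" "d = c \<circ> transpose 1 q"
      and r: "r \<in> {2..k}" "b = d \<circ> transpose 1 r"
      using b star_edge_iff by metis
    let ?g = "transpose 1 i \<circ> transpose 1 j"
    let ?h = "transpose 1 l \<circ> transpose 1 p \<circ> transpose 1 q \<circ> transpose 1 r"
    \<comment> \<open>Both products carry \<open>v\<close> to \<open>b\<close>. On
      \<open>{1..k}\<close> injectivity of \<open>v\<close> cancels it; outside, every transposition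
      involved acts as the identity.\<close>
    have "?g = ?h"
    proof
      fix x
      show "?g x = ?h x"
      proof (cases "x \<in> {1..k}")
        case True
        have "b = v \<circ> ?g" "b = v \<circ> ?h" using j r q p l v by (simp_all add: comp_assoc)
        then have "v (?g x) = v (?h x)" by (metis comp_apply)
        moreover have "?g x \<in> {1..k}" "?h x \<in> {1..k}"
          using True v(2) j p q r l by (simp_all only: comp_apply transpose_in_positions_iff)
        ultimately show ?thesis using k_perms_eq_iff[OF v(1)] by blast
      next
        case False
        then have "transpose 1 m x = x" if "m \<in> {2..k}" for m
          using that by (auto simp: transpose_def)
        then show ?thesis using v(2) j p q r l by simp
      qed
    qed
    \<comment> \<open>That the walks do not backtrack gives exactly the inequalities of
      \<open>star_transposition_relation\<close>.\<close>
    moreover have "l \<noteq> i" using assms(3) l v by auto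
    moreover have "j \<noteq> i" using b(2) j v by (auto simp: comp_assoc)
    moreover have "p \<noteq> l" using b(3) p l by (auto simp: comp_assoc)
    ultimately have "l = j"
      using star_transposition_relation[of l i j p q r] v(2) j p q r l by auto
    then show ?thesis using j by simp
  qed
  then show ?thesis using b b' by metis
qed

section \<open>Automorphisms preserve edge types\<close>

lemma Aut_iff:
  "f \<in> carrier (nk_star_Aut n k) \<longleftrightarrow>
     f \<in> Bij V \<and> (\<forall>a\<in>V. \<forall>b\<in>V. {f a, f b} \<in> E \<longleftrightarrow> {a, b} \<in> E)"
  by (simp add: graph_Aut_def)

context
  fixes f assumes f: "f \<in> carrier (nk_star_Aut n k)"
begin

lemma Aut_bij: "bij_betw f V V"
  using f by (simp add: Aut_iff Bij_def)

lemma Aut_in_V: "a \<in> V \<Longrightarrow> f a \<in> V"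
  using Aut_bij by (rule bij_betwE[THEN bspec])

lemma Aut_inj: "a \<in> V \<Longrightarrow> b \<in> V \<Longrightarrow> f a = f b \<longleftrightarrow> a = b"
  using Aut_bij by (auto simp: bij_betw_def inj_on_eq_iff)

lemma Aut_edge: "a \<in> V \<Longrightarrow> b \<in> V \<Longrightarrow> {f a, f b} \<in> E \<longleftrightarrow> {a, b} \<in> E"
  using f by (simp add: Aut_iff)

lemma Aut_residual:
  assumes "a \<in> V" "b \<in> V"
  shows "{f a, f b} \<in> R \<longleftrightarrow> {a, b} \<in> R"
proof -
  \<comment> \<open>A common neighbour of the images is itself an image, because \<open>f\<close>
    maps onto \<open>V\<close>.\<close>
  have "(\<exists>c. {f a, c} \<in> E \<and> {f b, c} \<in> E) \<longleftrightarrow> (\<exists>c\<in>f ` V. {f a, c} \<in> E \<and> {f b, c} \<in> E)"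
    using Aut_bij edge_in_V unfolding bij_betw_def by blast
  also have "\<dots> \<longleftrightarrow> (\<exists>c\<in>V. {a, c} \<in> E \<and> {b, c} \<in> E)"
    using Aut_edge assms by blast
  also have "\<dots> \<longleftrightarrow> (\<exists>c. {a, c} \<in> E \<and> {b, c} \<in> E)"
    using edge_in_V by blast
  finally show ?thesis unfolding residual_edge_iff_triangle using Aut_edge assms by blast
qed

lemma Aut_star:
  assumes "a \<in> V" "b \<in> V"
  shows "{f a, f b} \<in> S \<longleftrightarrow> {a, b} \<in> S"
  unfolding star_edge_iff_not_residual using Aut_edge Aut_residual assms by blast

lemma Aut_residual_imp: "{a, b} \<in> R \<Longrightarrow> {f a, f b} \<in> R"
  using Aut_residual E_iff edge_in_V by blast

lemma Aut_star_imp: "{a, b} \<in> S \<Longrightarrow> {f a, f b} \<in> S"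
  using Aut_star E_iff edge_in_V by blast

lemma Aut_residual_nbrs:
  assumes "a \<in> V"
  shows "bij_betw f (residual_nbrs n k a) (residual_nbrs n k (f a))"
  unfolding residual_nbrs_def by (rule bij_betw_Collect[OF Aut_bij]) (simp add: Aut_residual assms)

lemma Aut_star_nbrs:
  assumes "a \<in> V"
  shows "bij_betw f (star_nbrs n k a) (star_nbrs n k (f a))"
  unfolding star_nbrs_def by (rule bij_betw_Collect[OF Aut_bij]) (simp add: Aut_star assms)

end

section \<open>Rigidity: agreement spreads along edges\<close>

definition agree_at where
  "agree_at f g a \<longleftrightarrow> a \<in> V \<and> f a = g a \<and> (\<forall>b. {a, b} \<in> E \<longrightarrow> f b = g b)"

text \<open>The closed neighbourhood, and not the vertex alone, is what can be propagated: a
  suitable \<open>w\<close> next to \<open>v\<close> is known to have the same image under both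
  maps, and together with the images of \<open>v\<close> and \<open>u\<close> it determines the
  image of \<open>b\<close>.\<close>

lemma agree_at_edge:
  assumes f: "f \<in> carrier (nk_star_Aut n k)" and g: "g \<in> carrier (nk_star_Aut n k)"
    and v: "agree_at f g v" and vu: "{v, u} \<in> E"
  shows "agree_at f g u"
proof -
  note imps = Aut_residual_imp[OF f] Aut_residual_imp[OF g] Aut_star_imp[OF f] Aut_star_imp[OF g]
  have V: "v \<in> V" "u \<in> V" using vu edge_in_V by auto
  have eq: "f v = g v" "\<And>w. {v, w} \<in> S \<Longrightarrow> f w = g w" "\<And>w. {v, w} \<in> R \<Longrightarrow> f w = g w"
    using v by (auto simp: agree_at_def E_iff)
  have equ: "f u = g u" using eq vu E_iff by blast
  have "f b = g b" if ub: "{u, b} \<in> E" for b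
  proof (cases "b = v")
    case False
    have bV: "b \<in> V" using ub edge_in_V by auto
    have ne: "f b \<noteq> f v" "g b \<noteq> f v"
      using False Aut_inj[OF f bV V(1)] Aut_inj[OF g bV V(1)] eq(1) by auto
    consider "{v, u} \<in> R" "{u, b} \<in> R" | "{v, u} \<in> R" "{u, b} \<in> S"
      | "{v, u} \<in> S" "{u, b} \<in> R" | "{v, u} \<in> S" "{u, b} \<in> S"
      using vu ub E_iff by blast
    then show ?thesis
    proof cases
      case 1
      \<comment> \<open>Residual edges alter only position 1, so \<open>b\<close> is itself a
        residual neighbour of \<open>v\<close>, where agreement is assumed.\<close>
      then have vb: "v i = b i" if "i \<in> {2..k}" for i
        using that by (simp add: residual_edge_iff)
      have "v 1 \<noteq> b 1"
      proof
        assume "v 1 = b 1"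
        then have "b i = v i" if "i \<in> {1..k}" for i using vb[of i] that by (cases "i = 1") auto
        then show False using k_perms_eqI[OF bV V(1)] False by blast
      qed
      then have "{v, b} \<in> R" using vb V bV by (auto simp: residual_edge_iff)
      then show ?thesis using eq by blast
    next
      case 2
      then obtain w c d where w: "{v, w} \<in> S" "{w, c} \<in> R" "{c, d} \<in> S" "{d, b} \<in> R"
        using res_star_res by blast
      have "f w = g w" using w(1) eq by blast
      \<comment> \<open>Rewriting \<open>g u\<close> and \<open>g w\<close> as \<open>f u\<close>
        and \<open>f w\<close> puts both image cycles over the same three vertices, so that
        uniqueness applies.\<close>
      then have "{f u, g b} \<in> S" "{f w, g c} \<in> R"
        using imps(4)[OF 2(2)] imps(2)[OF w(2)] equ by simp_all
      then show ?thesis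
        using res_star_res_unique[of "f v" "f u" "f w" "f b" "f c" "f d" "g b" "g c" "g d"]
          2 w imps by blast
    next
      case 3
      then obtain w c d where w: "{v, w} \<in> R" "{w, c} \<in> S" "{c, d} \<in> R" "{d, b} \<in> S"
        using star_res_star by blast
      have "f w = g w" using w(1) eq by blast
      then have "{f u, g b} \<in> R" "{f w, g c} \<in> S"
        using imps(2)[OF 3(2)] imps(4)[OF w(2)] equ by simp_all
      then show ?thesis
        using star_res_star_unique[of "f v" "f u" "f w" "f b" "f c" "f d" "g b" "g c" "g d"]
          3 w imps by blast
    next
      case 4
      then obtain w c d where w: "{v, w} \<in> S" "w \<noteq> u" "c \<noteq> v" "{w, c} \<in> S" "{c, d} \<in> S" "{d, b} \<in> S"
        using star_star_star False by blast
      have wV: "w \<in> V" "c \<in> V" using w E_iff edge_in_V by blast+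
      \<comment> \<open>Uniqueness for star cycles excludes backtracking; injectivity carries this
        over to the images.\<close>
      have "f w \<noteq> f u" "f c \<noteq> f v" "g c \<noteq> f v"
        using w(2,3) Aut_inj[OF f wV(1) V(2)] Aut_inj[OF f wV(2) V(1)] Aut_inj[OF g wV(2) V(1)] eq(1)
        by simp_all
      moreover have "f w = g w" using w(1) eq by blast
      then have "{f u, g b} \<in> S" "{f w, g c} \<in> S"
        using imps(4)[OF 4(2)] imps(4)[OF w(4)] equ by simp_all
      ultimately show ?thesis
        using star_star_star_unique[of "f v" "f u" "f w" "f b" "f c" "f d" "g b" "g c" "g d"]
          4 w imps ne by blast
    qed
  qed (use eq in simp)
  then show ?thesis using V equ by (simp add: agree_at_def)
qed

text \<open>A replacement away from position 1 is not an edge but a walk of three: exchange the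
  symbol to the front, replace it there along a residual edge, and exchange back.\<close>

lemma agree_at_upd:
  assumes fg: "f \<in> carrier (nk_star_Aut n k)" "g \<in> carrier (nk_star_Aut n k)"
    and a: "agree_at f g a" and i: "i \<in> {1..k}" and y: "y \<in> {1..n} - a ` {1..k}"
  shows "agree_at f g (a(i := y))"
proof (cases "i = 1")
  case True
  have "{a, a(i := y)} \<in> R" using a y True residual_edge_upd by (auto simp: agree_at_def)
  then show ?thesis using agree_at_edge[OF fg a] E_iff by blast
next
  case False
  then have i: "i \<in> {2..k}" using i by auto
  define b where "b = a \<circ> transpose 1 i"
  have ab: "{a, b} \<in> S" using a i star_edge_iff unfolding b_def agree_at_def by blast
  then have b: "agree_at f g b" using agree_at_edge[OF fg a] E_iff by blast
  have "y \<in> {1..n} - b ` {1..k}" using y star_edge_image[OF ab] by simp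
  then have "{b, b(1 := y)} \<in> R" using b residual_edge_upd by (auto simp: agree_at_def)
  then have c: "agree_at f g (b(1 := y))" using agree_at_edge[OF fg b] E_iff by blast
  have "{b(1 := y), b(1 := y) \<circ> transpose 1 i} \<in> S"
    using c i star_edge_iff unfolding agree_at_def by blast
  then have "agree_at f g (b(1 := y) \<circ> transpose 1 i)" using agree_at_edge[OF fg c] E_iff by blast
  moreover have "b(1 := y) \<circ> transpose 1 i = a(i := y)"
    using i by (auto simp: b_def fun_eq_iff transpose_def)
  ultimately show ?thesis by simp
qed

lemma k_perms_update_induct:
  assumes "a \<in> V" "P a" and b: "b \<in> V"
    and step: "\<And>c i y. c \<in> V \<Longrightarrow> P c \<Longrightarrow> i \<in> {1..k} \<Longrightarrow> y \<in> {1..n} - c ` {1..k} \<Longrightarrow> P (c(i := y))"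
  shows "P b"
  using assms(1,2)
proof (induction "card {i \<in> {1..k}. a i \<noteq> b i}" arbitrary: a rule: less_induct)
  case (less a)
  let ?D = "\<lambda>a. {i \<in> {1..k}. a i \<noteq> b i}"
  have smaller: "card (?D c) < card (?D a)" if "i \<in> ?D a" "?D c \<subseteq> ?D a - {i}" for c i
    using that by (intro psubset_card_mono) auto
  show ?case
  proof (cases "?D a = {}")
    case True
    then have "a = b" using less.prems(1) b by (intro k_perms_eqI[of a n k b]) auto
    then show ?thesis using less.prems by simp
  next
    case False
    then obtain i where i: "i \<in> {1..k}" "a i \<noteq> b i" by auto
    have bi: "b i \<in> {1..n}" using b i(1) by (rule k_perms_range)
    show ?thesis
    proof (cases "b i \<in> a ` {1..k}")
      case False
      then have *: "b i \<in> {1..n} - a ` {1..k}" using bi by blast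
      show ?thesis
      proof (rule less.hyps[of "a(i := b i)"])
        show "card (?D (a(i := b i))) < card (?D a)" by (rule smaller[of i]) (use i in auto)
      qed (use i(1) less.prems * step k_perms_fun_upd in blast)+
    next
      case True
      then obtain j where j: "j \<in> {1..k}" "a j = b i" by auto
      have ji: "j \<noteq> i" using i j by auto
      then have bj: "b j \<noteq> a j" using k_perms_eq_iff[OF b j(1) i(1)] j(2) by simp
      \<comment> \<open>The symbol b i is blocked at position j, where a and b differ, so it is first freed there.\<close>
      obtain y where y: "y \<in> {1..n} - a ` {1..k}" using fresh_symbol[OF less.prems(1)] by blast
      define c where "c = a(j := y)"
      have c: "c \<in> V" "P c"
        using less.prems j(1) y k_perms_fun_upd step by (auto simp: c_def)
      have "c l \<noteq> b i" if "l \<in> {1..k}" for l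
      proof (cases "l = j")
        case True
        moreover have "y \<noteq> a j" using y j(1) by blast
          ultimately show ?thesis using j(2) by (simp add: c_def)
      next
        case False
        then show ?thesis using k_perms_eq_iff[OF less.prems(1) that j(1)] j(2) by (simp add: c_def)
      qed
      then have *: "b i \<in> {1..n} - c ` {1..k}" using bi by force
      \<comment> \<open>Position \<open>j\<close> was a disagreement before, so the detour loses
        nothing and the agreement at \<open>i\<close> is gained.\<close>
      have sub: "?D (c(i := b i)) \<subseteq> ?D a - {i}" using bj j(1) by (auto simp: c_def split: if_splits)
      show ?thesis
      proof (rule less.hyps[of "c(i := b i)"])
        show "card (?D (c(i := b i))) < card (?D a)" by (rule smaller[OF _ sub]) (use i in auto)
      qed (use i(1) c * step k_perms_fun_upd in blast)+
    qed
  qed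
qed

lemma Aut_eqI:
  assumes f: "f \<in> carrier (nk_star_Aut n k)" and g: "g \<in> carrier (nk_star_Aut n k)"
    and v: "v \<in> V" "f v = g v"
    and nbrs: "\<And>u. u \<in> residual_nbrs n k v \<Longrightarrow> f u = g u" "\<And>w. w \<in> star_nbrs n k v \<Longrightarrow> f w = g w"
  shows "f = g"
proof (rule extensionalityI[of _ V])
  \<comment> \<open>Automorphisms are \<open>undefined\<close> outside \<open>V\<close>, so equality
    only has to be checked on vertices.\<close>
  show "f \<in> extensional V" "g \<in> extensional V" using f g by (auto simp: Aut_iff Bij_def)
  have "agree_at f g v"
    using v nbrs edge_in_V
    by (auto simp: agree_at_def E_iff residual_nbrs_def star_nbrs_def insert_commute)
  then have "agree_at f g x" if "x \<in> V" for x
    using k_perms_update_induct[of v "agree_at f g" x] agree_at_upd[OF f g] v that by blast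
  then show "f x = g x" if "x \<in> V" for x using that by (auto simp: agree_at_def)
qed

section \<open>Automorphisms from permutations of symbols and positions\<close>

context
  fixes \<mu> \<nu> :: "nat \<Rightarrow> nat"
  assumes \<mu>: "\<mu> permutes {1..n}" and \<nu>: "\<nu> permutes {2..k}"
begin

lemma phi_apply:
  "phi n k (\<mu>, \<nu>) a = (if a \<in> V then \<lambda>i\<in>{1..k}. \<mu> (a (inv' \<nu> i)) else undefined)"
  by (simp add: phi_def)

lemma inv_nu_in_positions: "inv' \<nu> i \<in> {1..k} \<longleftrightarrow> i \<in> {1..k}"
proof -
  have "inv' \<nu> permutes {1..k}"
    by (rule permutes_subset[OF permutes_inv[OF \<nu>]]) auto
  then show ?thesis by (rule permutes_in_image)
qed

lemma inv_nu_eq_1_iff: "inv' \<nu> i = 1 \<longleftrightarrow> i = 1"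
  using permutes_not_in[OF \<nu>, of 1] by (auto simp: permutes_inv_eq[OF \<nu>])

lemma inv_nu_1: "inv' \<nu> 1 = 1"
  by (simp only: inv_nu_eq_1_iff)

lemma phi_in_V:
  assumes a: "a \<in> V"
  shows "phi n k (\<mu>, \<nu>) a \<in> V"
proof -
  have "phi n k (\<mu>, \<nu>) a \<in> {1..k} \<rightarrow>\<^sub>E {1..n}"
    unfolding phi_apply using a k_perms_range[OF a] permutes_in_image[OF \<mu>] inv_nu_in_positions
    by (simp only: if_True PiE_restrict restrict_PiE_iff) blast
  moreover have "inj_on (phi n k (\<mu>, \<nu>) a) {1..k}"
  proof (rule inj_onI)
    fix i j assume ij: "i \<in> {1..k}" "j \<in> {1..k}" "phi n k (\<mu>, \<nu>) a i = phi n k (\<mu>, \<nu>) a j"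
    then have "\<mu> (a (inv' \<nu> i)) = \<mu> (a (inv' \<nu> j))" using a by (simp add: phi_apply)
    then have "a (inv' \<nu> i) = a (inv' \<nu> j)" using permutes_inj[OF \<mu>] by (simp add: inj_eq)
    then have "inv' \<nu> i = inv' \<nu> j"
      using k_perms_inj[OF a] ij inv_nu_in_positions by blast
    then show "i = j" using permutes_inj[OF permutes_inv[OF \<nu>]] by (simp add: inj_eq)
  qed
  ultimately show ?thesis by (simp add: k_perms_def)
qed

text \<open>\<open>\<nu>\<close> fixes 1, so conjugation by it turns the transposition of 1 and
  \<open>i\<close> into that of 1 and \<open>\<nu> i\<close>. The star neighbours thus record
  \<open>\<nu>\<close>.\<close>

lemma phi_transpose:
  assumes a: "a \<in> V" and i: "i \<in> {2..k}"
  shows "phi n k (\<mu>, \<nu>) (a \<circ> transpose 1 i) = phi n k (\<mu>, \<nu>) a \<circ> transpose 1 (\<nu> i)"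
proof
  fix q
  have \<nu>i: "\<nu> i \<in> {2..k}" using permutes_in_image[OF \<nu>] i by blast
  have "transpose 1 i (inv' \<nu> q) = inv' \<nu> (transpose 1 (\<nu> i) q)"
  proof -
    consider "q = 1" | "q = \<nu> i" "q \<noteq> 1" | "q \<noteq> 1" "q \<noteq> \<nu> i" by blast
    then show ?thesis
    proof cases
      case 3
      then have "inv' \<nu> q \<noteq> 1" "inv' \<nu> q \<noteq> i"
        using inv_nu_eq_1_iff[of q] permutes_inv_eq[OF \<nu>, of q i] by simp_all
      then show ?thesis using 3 by simp
    qed (use inv_nu_1 permutes_inverses(2)[OF \<nu>, of i] in simp_all)
  qed
  then show "phi n k (\<mu>, \<nu>) (a \<circ> transpose 1 i) q = (phi n k (\<mu>, \<nu>) a \<circ> transpose 1 (\<nu> i)) q"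
    using a transpose_in_k_perms[OF a i] transpose_in_positions_iff[OF \<nu>i, of q]
    unfolding phi_apply by (simp only: if_True comp_apply restrict_def)
qed

lemma phi_fun_upd:
  assumes a: "a \<in> V" and x: "x \<in> {1..n} - a ` {1..k}"
  shows "phi n k (\<mu>, \<nu>) (a(1 := x)) = (phi n k (\<mu>, \<nu>) a)(1 := \<mu> x)"
proof
  fix q
  have "a(1 := x) \<in> V" using k_perms_fun_upd[OF a _ x, of 1] k by simp
  then show "phi n k (\<mu>, \<nu>) (a(1 := x)) q = ((phi n k (\<mu>, \<nu>) a)(1 := \<mu> x)) q"
    using a k inv_nu_eq_1_iff[of q] inv_nu_1 by (cases "q = 1") (simp_all add: phi_apply)
qed

lemma phi_edge:
  assumes "{a, b} \<in> E"
  shows "{phi n k (\<mu>, \<nu>) a, phi n k (\<mu>, \<nu>) b} \<in> E"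
proof (cases "{a, b} \<in> S")
  case True
  then obtain i where "a \<in> V" "i \<in> {2..k}" "b = a \<circ> transpose 1 i" using star_edge_iff by blast
  then have "{phi n k (\<mu>, \<nu>) a, phi n k (\<mu>, \<nu>) b} \<in> S"
    using phi_transpose phi_in_V permutes_in_image[OF \<nu>] by (auto simp: star_edge_iff)
  then show ?thesis by (simp add: E_iff)
next
  case False
  then have "{a, b} \<in> R" using assms E_iff by blast
  then obtain x where x: "a \<in> V" "b \<in> V" "x \<in> {1..n} - a ` {1..k}" "b = a(1 := x)"
    using residual_edge_upd edge_in_V assms by blast
  then have eq: "phi n k (\<mu>, \<nu>) b = (phi n k (\<mu>, \<nu>) a)(1 := \<mu> x)" using phi_fun_upd by simp
  have "a 1 \<noteq> x" using x(3) k by force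
  then have "\<mu> (a 1) \<noteq> \<mu> x" using permutes_inj[OF \<mu>] by (simp add: inj_eq)
  then have "phi n k (\<mu>, \<nu>) a 1 \<noteq> \<mu> x" using x(1) inv_nu_1 k by (simp add: phi_apply)
  then have "{phi n k (\<mu>, \<nu>) a, phi n k (\<mu>, \<nu>) b} \<in> R"
    using eq phi_in_V[OF x(1)] phi_in_V[OF x(2)] by (simp add: residual_edge_iff)
  then show ?thesis by (simp add: E_iff)
qed

end

text \<open>Acting on positions by precomposition reverses products, and so does inversion; using
  the inverse of \<open>\<nu>\<close> makes the two reversals cancel.\<close>

lemma phi_comp:
  assumes \<mu>: "\<mu> permutes {1..n}" "\<mu>' permutes {1..n}" and \<nu>: "\<nu> permutes {2..k}" "\<nu>' permutes {2..k}"
    and a: "a \<in> V"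
  shows "phi n k (\<mu>, \<nu>) (phi n k (\<mu>', \<nu>') a) = phi n k (\<mu> \<circ> \<mu>', \<nu> \<circ> \<nu>') a"
proof
  fix i
  have "inv' (\<nu> \<circ> \<nu>') = inv' \<nu>' \<circ> inv' \<nu>"
    using \<nu> by (intro o_inv_distrib permutes_bij)
  then show "phi n k (\<mu>, \<nu>) (phi n k (\<mu>', \<nu>') a) i = phi n k (\<mu> \<circ> \<mu>', \<nu> \<circ> \<nu>') a i"
    using phi_in_V[OF \<mu>(2) \<nu>(2) a] a inv_nu_in_positions[OF \<mu>(1) \<nu>(1), of i]
    by (simp add: phi_def)
qed

lemma phi_id: "a \<in> V \<Longrightarrow> phi n k (id, id) a = a"
  by (auto simp: phi_def k_perms_def PiE_def extensional_restrict)

lemma phi_inverse: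
  assumes "\<mu> permutes {1..n}" "\<nu> permutes {2..k}" "a \<in> V"
  shows "phi n k (\<mu>, \<nu>) (phi n k (inv' \<mu>, inv' \<nu>) a) = a"
    and "phi n k (inv' \<mu>, inv' \<nu>) (phi n k (\<mu>, \<nu>) a) = a"
  using assms by (simp_all add: phi_comp permutes_inv permutes_inv_o phi_id)

lemma phi_in_Aut:
  assumes "\<mu> permutes {1..n}" "\<nu> permutes {2..k}"
  shows "phi n k (\<mu>, \<nu>) \<in> carrier (nk_star_Aut n k)"
proof -
  note inv = permutes_inv[OF assms(1)] permutes_inv[OF assms(2)]
  have "bij_betw (phi n k (\<mu>, \<nu>)) V V"
    by (rule bij_betw_byWitness[of _ "phi n k (inv' \<mu>, inv' \<nu>)"])
      (use assms inv phi_inverse phi_in_V in auto)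
  moreover have "phi n k (\<mu>, \<nu>) \<in> extensional V" by (simp add: phi_def)
  \<comment> \<open>Edges are reflected because the inverse pair preserves them too.\<close>
  moreover have "{a, b} \<in> E" if "a \<in> V" "b \<in> V" "{phi n k (\<mu>, \<nu>) a, phi n k (\<mu>, \<nu>) b} \<in> E" for a b
    using phi_edge[OF inv that(3)] phi_inverse[OF assms] that by simp
  ultimately show ?thesis
    using phi_edge[OF assms] by (auto simp: Aut_iff Bij_def)
qed

lemma phi_hom: "phi n k \<in> hom (sym_group n \<times>\<times> sym_subgroup n k) (nk_star_Aut n k)"
proof (rule homI)
  fix p assume "p \<in> carrier (sym_group n \<times>\<times> sym_subgroup n k)"
  then show "phi n k p \<in> carrier (nk_star_Aut n k)"
    using phi_in_Aut n by (cases p) (simp add: carrier_sym_subgroup sym_group_carrier)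
next
  fix p q assume pq: "p \<in> carrier (sym_group n \<times>\<times> sym_subgroup n k)"
    "q \<in> carrier (sym_group n \<times>\<times> sym_subgroup n k)"
  obtain \<mu> \<nu> \<mu>' \<nu>' where eq: "p = (\<mu>, \<nu>)" "q = (\<mu>', \<nu>')" by (cases p, cases q)
  then have perm: "\<mu> permutes {1..n}" "\<mu>' permutes {1..n}" "\<nu> permutes {2..k}" "\<nu>' permutes {2..k}"
    using pq n by (simp_all add: carrier_sym_subgroup sym_group_carrier)
  then have Bij: "phi n k (\<mu>, \<nu>) \<in> Bij V" "phi n k (\<mu>', \<nu>') \<in> Bij V"
    using phi_in_Aut by (auto simp: Aut_iff)
  have "phi n k (\<mu> \<circ> \<mu>', \<nu> \<circ> \<nu>') = compose V (phi n k (\<mu>, \<nu>)) (phi n k (\<mu>', \<nu>'))"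
    by (rule extensionalityI[of _ V]) (use perm in \<open>auto simp: phi_comp compose_eq, simp add: phi_def\<close>)
  then show "phi n k (p \<otimes>\<^bsub>sym_group n \<times>\<times> sym_subgroup n k\<^esub> q) =
      phi n k p \<otimes>\<^bsub>nk_star_Aut n k\<^esub> phi n k q"
    using Bij by (simp add: eq graph_Aut_def BijGroup_def sym_subgroup_def sym_group_mult)
qed

section \<open>Injectivity\<close>

lemma V_nonempty: "V \<noteq> {}"
proof -
  have "(\<lambda>i\<in>{1..k}. i) \<in> V" using n by (auto simp: k_perms_def inj_on_def)
  then show ?thesis by blast
qed

text \<open>A symbol already in the tuple is exchanged to the front, any other is inserted there.
  This lets \<open>\<mu>\<close> be read off at the position that \<open>\<nu>\<close> cannot
  move.\<close>

lemma symbol_in_first_position: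
  assumes "x \<in> {1..n}"
  shows "\<exists>a\<in>V. a 1 = x"
proof -
  obtain a where a: "a \<in> V" using V_nonempty by blast
  show ?thesis
  proof (cases "x \<in> a ` {1..k}")
    case True
    then obtain i where i: "i \<in> {1..k}" "x = a i" by blast
    show ?thesis
    proof (cases "i = 1")
      case False
      then have "a \<circ> transpose 1 i \<in> V" using i a transpose_in_k_perms by simp
      then show ?thesis using i by (intro bexI[of _ "a \<circ> transpose 1 i"]) simp_all
    qed (use a i in blast)
  next
    case False
    then have "a(1 := x) \<in> V" using k_perms_fun_upd[OF a, of 1 x] k assms by simp
    then show ?thesis by (intro bexI[of _ "a(1 := x)"]) simp_all
  qed
qed

lemma phi_inj: "inj_on (phi n k) ({p. p permutes {1..n}} \<times> {p. p permutes {2..k}})"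
proof (rule inj_onI, clarify)
  fix \<mu> \<nu> \<mu>' \<nu>'
  assume perm: "\<mu> permutes {1..n}" "\<nu> permutes {2..k}" "\<mu>' permutes {1..n}" "\<nu>' permutes {2..k}"
    and eq: "phi n k (\<mu>, \<nu>) = phi n k (\<mu>', \<nu>')"
  have eq: "\<mu> (a (inv' \<nu> i)) = \<mu>' (a (inv' \<nu>' i))" if "a \<in> V" "i \<in> {1..k}" for a i
    using fun_cong[OF fun_cong[OF eq, of a], of i] that by (simp add: phi_def)
  have \<mu>: "\<mu> = \<mu>'"
  proof
    fix x
    show "\<mu> x = \<mu>' x"
    proof (cases "x \<in> {1..n}")
      case True
      then obtain a where "a \<in> V" "a 1 = x" using symbol_in_first_position by blast
      then show ?thesis using eq[of a 1] inv_nu_1[OF perm(1,2)] inv_nu_1[OF perm(3,4)] k by simp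
    next
      case False
      then show ?thesis using permutes_not_in[OF perm(1)] permutes_not_in[OF perm(3)] by simp
    qed
  qed
  \<comment> \<open>One vertex suffices here: with \<open>\<mu>\<close> settled, its distinct
    symbols tell the positions apart.\<close>
  obtain a where a: "a \<in> V" using V_nonempty by blast
  have "inv' \<nu> = inv' \<nu>'"
  proof
    fix i
    show "inv' \<nu> i = inv' \<nu>' i"
    proof (cases "i \<in> {1..k}")
      case True
      have "a (inv' \<nu> i) = a (inv' \<nu>' i)"
        using eq[OF a True] \<mu> permutes_inj[OF perm(3)] by (simp add: inj_eq)
      then show ?thesis
        using k_perms_inj[OF a] inv_nu_in_positions[OF perm(1,2)] inv_nu_in_positions[OF perm(3,4)]
          True by blast
    next
      case False
      then have "i \<notin> {2..k}" by auto
      then show ?thesis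
        using permutes_not_in[OF permutes_inv[OF perm(2)]] permutes_not_in[OF permutes_inv[OF perm(4)]]
        by simp
    qed
  qed
  then have "\<nu> = \<nu>'" using permutes_inv_inv perm(2,4) by metis
  with \<mu> show "\<mu> = \<mu>' \<and> \<nu> = \<nu>'" by simp
qed

section \<open>Prescribing a vertex and its neighbours\<close>

lemma bij_betw_residual_nbrs:
  assumes "v \<in> V"
  shows "bij_betw (\<lambda>x. v(1 := x)) ({1..n} - v ` {1..k}) (residual_nbrs n k v)"
proof -
  have "residual_nbrs n k v = (\<lambda>x. v(1 := x)) ` ({1..n} - v ` {1..k})"
    using assms k_perms_fun_upd[OF assms, of 1] k
    unfolding residual_nbrs_def insert_commute[of _ v "{}"] residual_edge_upd by auto
  moreover have "inj_on (\<lambda>x. v(1 := x)) A" for A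
    by (rule inj_onI) (metis fun_upd_same)
  ultimately show ?thesis by (simp add: bij_betw_def)
qed

lemma bij_betw_star_nbrs:
  assumes v: "v \<in> V"
  shows "bij_betw (\<lambda>i. v \<circ> transpose 1 i) {2..k} (star_nbrs n k v)"
proof -
  have "star_nbrs n k v = (\<lambda>i. v \<circ> transpose 1 i) ` {2..k}"
    using v transpose_in_k_perms[OF v]
    unfolding star_nbrs_def insert_commute[of _ v "{}"] star_edge_iff by auto
  moreover have "inj_on (\<lambda>i. v \<circ> transpose 1 i) {2..k}"
  proof (rule inj_onI)
    fix i j assume ij: "i \<in> {2..k}" "j \<in> {2..k}" "v \<circ> transpose 1 i = v \<circ> transpose 1 j"
    have "v i = v j" using fun_cong[OF ij(3), of 1] by simp
    then show "i = j" using k_perms_inj[OF v, of i j] ij(1,2) by auto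
  qed
  ultimately show ?thesis by (simp add: bij_betw_def)
qed

lemma phi_extends_local_data:
  assumes v: "v \<in> V" and v': "v' \<in> V"
    and u: "bij_betw u I (residual_nbrs n k v)" and u': "bij_betw u' I (residual_nbrs n k v')"
    and w: "bij_betw w J (star_nbrs n k v)" and w': "bij_betw w' J (star_nbrs n k v')"
  obtains \<mu> \<nu> where "\<mu> permutes {1..n}" "\<nu> permutes {2..k}" "phi n k (\<mu>, \<nu>) v = v'"
    "\<And>i. i \<in> I \<Longrightarrow> phi n k (\<mu>, \<nu>) (u i) = u' i" "\<And>j. j \<in> J \<Longrightarrow> phi n k (\<mu>, \<nu>) (w j) = w' j"
proof -
  obtain x where x: "bij_betw x I ({1..n} - v ` {1..k})" "\<And>i. i \<in> I \<Longrightarrow> u i = v(1 := x i)"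
    using enumeration_through_bijection[OF bij_betw_residual_nbrs[OF v] u] by blast
  obtain x' where x': "bij_betw x' I ({1..n} - v' ` {1..k})" "\<And>i. i \<in> I \<Longrightarrow> u' i = v'(1 := x' i)"
    using enumeration_through_bijection[OF bij_betw_residual_nbrs[OF v'] u'] by blast
  obtain p where p: "bij_betw p J {2..k}" "\<And>j. j \<in> J \<Longrightarrow> w j = v \<circ> transpose 1 (p j)"
    using enumeration_through_bijection[OF bij_betw_star_nbrs[OF v] w] by blast
  obtain p' where p': "bij_betw p' J {2..k}" "\<And>j. j \<in> J \<Longrightarrow> w' j = v' \<circ> transpose 1 (p' j)"
    using enumeration_through_bijection[OF bij_betw_star_nbrs[OF v'] w'] by blast
  obtain \<nu> where \<nu>: "\<nu> permutes {2..k}" "\<And>j. j \<in> J \<Longrightarrow> \<nu> (p j) = p' j"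
    using permutation_between_enumerations[OF p(1) p'(1)] by blast
  have range: "a ` {1..k} \<union> ({1..n} - a ` {1..k}) = {1..n}" if "a \<in> V" for a
    using k_perms_range[OF that] by blast
  have "\<nu> permutes {1..k}" by (rule permutes_subset[OF \<nu>(1)]) auto
  \<comment> \<open>\<open>phi\<close> reads \<open>v\<close> through the inverse of
    \<open>\<nu>\<close>, so \<open>\<mu>\<close> has to send \<open>v i\<close> to
    \<open>v' (\<nu> i)\<close> for the result to be \<open>v'\<close>.\<close>
  then have "bij_betw (v' \<circ> \<nu>) {1..k} (v' ` {1..k})"
    using v' by (intro bij_betw_trans[OF permutes_imp_bij]) (auto simp: bij_betw_def k_perms_def)
  then have g: "bij_betw (case_sum (v' \<circ> \<nu>) x') ({1..k} <+> I) {1..n}"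
    using bij_betw_case_sum[OF _ x'(1)] range[OF v'] by (metis Diff_disjoint)
  have "bij_betw v {1..k} (v ` {1..k})" using v by (auto simp: bij_betw_def k_perms_def)
  then have f: "bij_betw (case_sum v x) ({1..k} <+> I) {1..n}"
    using bij_betw_case_sum[OF _ x(1)] range[OF v] by (metis Diff_disjoint)
  obtain \<mu> where \<mu>: "\<mu> permutes {1..n}"
      "\<And>i. i \<in> {1..k} <+> I \<Longrightarrow> \<mu> (case_sum v x i) = case_sum (v' \<circ> \<nu>) x' i"
    using permutation_between_enumerations[OF f g] by blast
  have \<mu>v: "\<mu> (v i) = v' (\<nu> i)" if "i \<in> {1..k}" for i using \<mu>(2)[OF InlI[OF that]] by simp
  have \<mu>x: "\<mu> (x i) = x' i" if "i \<in> I" for i using \<mu>(2)[OF InrI[OF that]] by simp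
  show thesis
  proof (rule that[OF \<mu>(1) \<nu>(1)])
    show phi_v: "phi n k (\<mu>, \<nu>) v = v'"
    proof (rule k_perms_eqI[OF phi_in_V[OF \<mu>(1) \<nu>(1) v] v'])
      fix i assume i: "i \<in> {1..k}"
      then have "\<mu> (v (inv' \<nu> i)) = v' i"
        using \<mu>v inv_nu_in_positions[OF \<mu>(1) \<nu>(1)] permutes_inverses[OF \<nu>(1)] by simp
      then show "phi n k (\<mu>, \<nu>) v i = v' i" using v i by (simp add: phi_def)
    qed
    show "phi n k (\<mu>, \<nu>) (u i) = u' i" if "i \<in> I" for i
    proof -
      have "x i \<in> {1..n} - v ` {1..k}" using bij_betwE[OF x(1)] that by blast
      then show ?thesis
        using phi_fun_upd[OF \<mu>(1) \<nu>(1) v] phi_v x(2) x'(2) \<mu>x that by simp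
    qed
    show "phi n k (\<mu>, \<nu>) (w j) = w' j" if "j \<in> J" for j
    proof -
      have "p j \<in> {2..k}" using bij_betwE[OF p(1)] that by blast
      then show ?thesis
        using phi_transpose[OF \<mu>(1) \<nu>(1) v] phi_v p(2) p'(2) \<nu>(2) that by simp
    qed
  qed
qed

section \<open>Surjectivity and unique extension\<close>

lemma phi_surj:
  assumes f: "f \<in> carrier (nk_star_Aut n k)"
  shows "f \<in> phi n k ` ({p. p permutes {1..n}} \<times> {p. p permutes {2..k}})"
proof -
  obtain v where v: "v \<in> V" using V_nonempty by blast
  \<comment> \<open>The neighbour sets of \<open>v\<close> index themselves, and their images under
    \<open>f\<close> are the prescribed targets.\<close>
  have id: "bij_betw (\<lambda>x. x) A A" for A :: "(nat \<Rightarrow> nat) set" by (simp add: bij_betw_def)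
  obtain \<mu> \<nu> where perm: "\<mu> permutes {1..n}" "\<nu> permutes {2..k}" and eq: "phi n k (\<mu>, \<nu>) v = f v"
    "\<And>u. u \<in> residual_nbrs n k v \<Longrightarrow> phi n k (\<mu>, \<nu>) u = f u"
    "\<And>w. w \<in> star_nbrs n k v \<Longrightarrow> phi n k (\<mu>, \<nu>) w = f w"
    using phi_extends_local_data[OF v Aut_in_V[OF f v] id Aut_residual_nbrs[OF f v]
        id Aut_star_nbrs[OF f v]] by blast
  have "phi n k (\<mu>, \<nu>) = f"
    using Aut_eqI[OF phi_in_Aut[OF perm] f v] eq by blast
  then show ?thesis using perm by blast
qed

lemma phi_iso: "phi n k \<in> iso (sym_group n \<times>\<times> sym_subgroup n k) (nk_star_Aut n k)"
proof -
  have C: "carrier (sym_group n \<times>\<times> sym_subgroup n k) = {p. p permutes {1..n}} \<times> {p. p permutes {2..k}}"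
    using n by (auto simp: carrier_sym_subgroup sym_group_carrier)
  have "phi n k ` carrier (sym_group n \<times>\<times> sym_subgroup n k) = carrier (nk_star_Aut n k)"
    using phi_in_Aut phi_surj unfolding C by blast
  then show ?thesis
    using phi_hom phi_inj unfolding iso_def bij_betw_def C by blast
qed

lemma ex1_Aut_local_data:
  assumes v: "v \<in> V" "v' \<in> V"
    and u: "bij_betw u I (residual_nbrs n k v)" "bij_betw u' I (residual_nbrs n k v')"
    and w: "bij_betw w J (star_nbrs n k v)" "bij_betw w' J (star_nbrs n k v')"
  shows "\<exists>!f. f \<in> carrier (nk_star_Aut n k) \<and> f v = v' \<and>
           (\<forall>i\<in>I. f (u i) = u' i) \<and> (\<forall>j\<in>J. f (w j) = w' j)"
proof (rule ex_ex1I)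
  show "\<exists>f. f \<in> carrier (nk_star_Aut n k) \<and> f v = v' \<and>
          (\<forall>i\<in>I. f (u i) = u' i) \<and> (\<forall>j\<in>J. f (w j) = w' j)"
    using phi_extends_local_data[OF v u w] phi_in_Aut by metis
next
  fix f g
  assume f: "f \<in> carrier (nk_star_Aut n k) \<and> f v = v' \<and>
      (\<forall>i\<in>I. f (u i) = u' i) \<and> (\<forall>j\<in>J. f (w j) = w' j)"
    and g: "g \<in> carrier (nk_star_Aut n k) \<and> g v = v' \<and>
      (\<forall>i\<in>I. g (u i) = u' i) \<and> (\<forall>j\<in>J. g (w j) = w' j)"
  \<comment> \<open>The enumerations are onto, so agreement at the indexed neighbours covers the
    whole neighbourhood of \<open>v\<close>.\<close>
  have "residual_nbrs n k v = u ` I" "star_nbrs n k v = w ` J"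
    using u(1) w(1) by (simp_all add: bij_betw_def)
  then show "f = g" using f g by (intro Aut_eqI[of f g v]) (auto simp: v)
qed

end

theorem theorem2p6:
  fixes n k :: nat
  assumes "k \<ge> 2" and "n \<ge> k + 2"
  shows "phi n k \<in> iso (sym_group n \<times>\<times> sym_subgroup n k) (nk_star_Aut n k) \<and>
    (\<forall>v \<in> k_perms n k. \<forall>v' \<in> k_perms n k. \<forall>u w u' w'.
       bij_betw u {1..n-k} (residual_nbrs n k v) \<and>
       bij_betw w {1..k-1} (star_nbrs n k v) \<and>
       bij_betw u' {1..n-k} (residual_nbrs n k v') \<and>
       bij_betw w' {1..k-1} (star_nbrs n k v') \<longrightarrow>
       (\<exists>!f. f \<in> carrier (nk_star_Aut n k) \<and> f v = v' \<and>
             (\<forall>i\<in>{1..n-k}. f (u i) = u' i) \<and>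
             (\<forall>i\<in>{1..k-1}. f (w i) = w' i)))"
proof -
  interpret star_graph n k by unfold_locales (use assms in auto)
  show ?thesis
  proof (intro conjI ballI allI impI phi_iso, elim conjE)
    fix v v' u w u' w'
    assume "v \<in> V" "v' \<in> V" "bij_betw u {1..n-k} (residual_nbrs n k v)"
      "bij_betw w {1..k-1} (star_nbrs n k v)" "bij_betw u' {1..n-k} (residual_nbrs n k v')"
      "bij_betw w' {1..k-1} (star_nbrs n k v')"
    then show "\<exists>!f. f \<in> carrier (nk_star_Aut n k) \<and> f v = v' \<and>
        (\<forall>i\<in>{1..n-k}. f (u i) = u' i) \<and> (\<forall>i\<in>{1..k-1}. f (w i) = w' i)"
      by (intro ex1_Aut_local_data)
  qed
qed

end
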